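(* Consider the port-Hamiltonian system $\dot{x}(t) = (J-D)Hx(t) + Bu(t)$, $x(t_0)=x_0$, on $[t_0,T]$ with state $x(t)\in\mathbb{R}^N$, where $H=H^{\mathsf T}\succ 0$, $J=-J^{\mathsf T}$, $D=D^{\mathsf T}\succeq 0$ are real $N\times N$ matrices, $B\in\mathbb{R}^{N\times m}$, and $u:[t_0,T]\to\mathbb{R}^m$. Let $V\in\mathbb{R}^{N\times n}$, $V_A\in\mathbb{R}^{N\times n_A}$, $V_H\in\mathbb{R}^{N\times n_H}$ be basis matrices of full column rank. Let - $x_r\in C^1([t_0,T],\mathbb{R}^n)$ be the solution of the reduced system $$V^{\mathsf T}HV\,\dot{x}_r(t) = V^{\mathsf T}H(J-D)HV\,x_r(t) + V^{\mathsf T}HB\,u(t),\qquad x_r(t_0)=V^{\mathsf T}Hx_0,$$ with induced error $e := x - Vx_r\in C^1([t_0,T],\mathbb{R}^N)$; - $e_r\in C^1([t_0,T],\mathbb{R}^{n_A})$ be the solution of the reduced auxiliary linear problem $$V_A^{\mathsf T}HV_A\,\dot{e}_r(t) = V_A^{\mathsf T}H(J-D)HV_A\,e_r(t) + V_A^{\mathsf T}H\,r(t),\qquad e_r(t_0)=0,$$ where $r(t) := (J-D)HVx_r(t) + Bu(t) - V\dot{x}_r(t)\in\mathbb{R}^N$, with second error $e_A := e - V_Ae_r\in C^1([t_0,T],\mathbb{R}^N)$; - $x_{H,r}\in C^1([t_0,T],\mathbb{R}^{n_H})$ be the solution of the reduced hierarchical system $$V_H^{\mathsf T}HV_H\,\dot{x}_{H,r}(t)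 = V_H^{\mathsf T}H(J-D)HV_H\,x_{H,r}(t) + V_H^{\mathsf T}HB\,u(t),\qquad x_{H,r}(t_0)=V_H^{\mathsf T}Hx_0.$$ If $V_A = V_H = \begin{bmatrix} V & V_+\end{bmatrix}$ for some $V_+\in\mathbb{R}^{N\times n_+}$ with $n_+ = n_A-n = n_H-n$, and if furthermore the initial values satisfy $$e_r(t_0) = x_{H,r}(t_0) - \begin{bmatrix} x_r(t_0)\\ 0_{n_+\times 1}\end{bmatrix},$$ then $$\Delta_A(t) = \Delta_H(t)\in\mathbb{R}_{\ge 0}\qquad\text{for all } t\in[t_0,T],$$ where $\Delta_A$ is the auxiliary-linear-problem (ALP) error bound and $\Delta_H$ is the hierarchical error bound (both defined in the context).
   Context: Energy norm: for $v\in\mathbb{R}^N$, $\|v\|_H := \sqrt{v^{\mathsf T}Hv}$. Approximations: $\hat{x}(t) := Vx_r(t)$, $\hat{e}(t) := V_Ae_r(t)$, $\hat{x}_H(t) := V_Hx_{H,r}(t)$, all in $\mathbb{R}^N$. Projections (the matrices $V_A^{\mathsf T}HV_A$ and $V_H^{\mathsf T}HV_H$ are invertible because $V_A$, $V_H$ have full column rank): $$\Pi_A := I - V_A(V_A^{\mathsf T}HV_A)^{-1}V_A^{\mathsf T}H,\qquad \Pi_H := I - V_H(V_H^{\mathsf T}HV_H)^{-1}V_H^{\mathsf T}H .$$ Residuals, with $r(t) = (J-D)HVx_r(t)+Bu(t)-V\dot{x}_r(t)$ the residual of the reduced system: $$r_A(t) := \Pi_A(J-D)H\hat{e}(t) +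 \Pi_A r(t),\qquad r_H(t) := \Pi_H(J-D)H\hat{x}_H(t) + \Pi_HBu(t).$$ ALP error bound: $$\Delta_A(t) := \|\hat{e}(t)\|_H + \int_{t_0}^t \|r_A(s)\|_H\,ds .$$ Hierarchical error bound: $$\Delta_H(t) := \|\hat{x}_H(t)-\hat{x}(t)\|_H + \int_{t_0}^t \|r_H(s)\|_H\,ds .$$ *)

theory Defs
  imports "HOL-Analysis.Analysis"
begin

definition symmetric_pos_def :: "real^'n^'n \<Rightarrow> bool" where
  "symmetric_pos_def A \<longleftrightarrow> transpose A = A \<and> (\<forall>v. v \<noteq> 0 \<longrightarrow> 0 < v \<bullet> (A *v v))"

definition symmetric_pos_semidef :: "real^'n^'n \<Rightarrow> bool" where
  "symmetric_pos_semidef A \<longleftrightarrow> transpose A = A \<and> (\<forall>v. 0 \<le> v \<bullet> (A *v v))"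

definition skew_symmetric :: "real^'n^'n \<Rightarrow> bool" where
  "skew_symmetric A \<longleftrightarrow> transpose A = - A"

definition full_column_rank :: "real^'k^'n \<Rightarrow> bool" where
  "full_column_rank W \<longleftrightarrow> rank W = CARD('k)"

definition energy_norm :: "real^'n^'n \<Rightarrow> real^'n \<Rightarrow> real" where
  "energy_norm H v = sqrt (v \<bullet> (H *v v))"

text \<open>
  Derivatives on the closed interval are taken within the interval, so they are one-sided at
  the end points and no values outside the interval matter.  The library predicate
  \<open>C1_differentiable_on\<close> uses two-sided derivatives and is therefore not used here.
\<close>

definition C1_on :: "real \<Rightarrow> real \<Rightarrow> (real \<Rightarrow> 'a::real_normed_vector) \<Rightarrow> bool" where
  "C1_on a b f \<longleftrightarrow> (\<exists>f'. continuous_on {a..b} f' \<and>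
     (\<forall>t\<in>{a..b}. (f has_vector_derivative f' t) (at t within {a..b})))"

abbreviation deriv_on :: "real \<Rightarrow> real \<Rightarrow> (real \<Rightarrow> 'a::real_normed_vector) \<Rightarrow> real \<Rightarrow> 'a" where
  "deriv_on a b f t \<equiv> vector_derivative f (at t within {a..b})"

definition ph_solution ::
  "real \<Rightarrow> real \<Rightarrow> real^'n^'n \<Rightarrow> real^'n^'n \<Rightarrow> real^'n^'n \<Rightarrow> real^'m^'n \<Rightarrow>
   (real \<Rightarrow> real^'m) \<Rightarrow> real^'n \<Rightarrow> (real \<Rightarrow> real^'n) \<Rightarrow> bool" where
  "ph_solution t0 T J D H B u x0 x \<longleftrightarrow> C1_on t0 T x \<and> x t0 = x0 \<and>
     (\<forall>t\<in>{t0..T}. deriv_on t0 T x t = (J - D) ** H *v x t + B *v u t)"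

text \<open>
  The three reduced systems share this form: \<open>W\<close> is the basis matrix, \<open>f\<close> the full-order
  source term (\<open>B u\<close> or the residual) and \<open>y0\<close> the reduced initial value.
\<close>

definition reduced_solution ::
  "real \<Rightarrow> real \<Rightarrow> real^'n^'n \<Rightarrow> real^'n^'n \<Rightarrow> real^'n^'n \<Rightarrow> real^'k^'n \<Rightarrow>
   (real \<Rightarrow> real^'n) \<Rightarrow> real^'k \<Rightarrow> (real \<Rightarrow> real^'k) \<Rightarrow> bool" where
  "reduced_solution t0 T J D H W f y0 y \<longleftrightarrow> C1_on t0 T y \<and> y t0 = y0 \<and>
     (\<forall>t\<in>{t0..T}. (transpose W ** H ** W) *v deriv_on t0 T y t =
        (transpose W ** H ** (J - D) ** H ** W) *v y t + (transpose W ** H) *v f t)"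

definition residual ::
  "real \<Rightarrow> real \<Rightarrow> real^'n^'n \<Rightarrow> real^'n^'n \<Rightarrow> real^'n^'n \<Rightarrow> real^'m^'n \<Rightarrow>
   (real \<Rightarrow> real^'m) \<Rightarrow> real^'k^'n \<Rightarrow> (real \<Rightarrow> real^'k) \<Rightarrow> real \<Rightarrow> real^'n" where
  "residual t0 T J D H B u V x_r t =
     ((J - D) ** H ** V) *v x_r t + B *v u t - V *v deriv_on t0 T x_r t"

definition compl_proj :: "real^'n^'n \<Rightarrow> real^'k^'n \<Rightarrow> real^'n^'n" where
  "compl_proj H W =
     mat 1 - W ** matrix_inv (transpose W ** H ** W) ** transpose W ** H"

definition alp_residual ::
  "real^'n^'n \<Rightarrow> real^'n^'n \<Rightarrow> real^'n^'n \<Rightarrow> real^'k^'n \<Rightarrow>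
   (real \<Rightarrow> real^'n) \<Rightarrow> (real \<Rightarrow> real^'k) \<Rightarrow> real \<Rightarrow> real^'n" where
  "alp_residual J D H V_A r e_r t =
     (compl_proj H V_A ** (J - D) ** H) *v (V_A *v e_r t) + compl_proj H V_A *v r t"

definition hier_residual ::
  "real^'n^'n \<Rightarrow> real^'n^'n \<Rightarrow> real^'n^'n \<Rightarrow> real^'m^'n \<Rightarrow> (real \<Rightarrow> real^'m) \<Rightarrow>
   real^'k^'n \<Rightarrow> (real \<Rightarrow> real^'k) \<Rightarrow> real \<Rightarrow> real^'n" where
  "hier_residual J D H B u V_H x_Hr t =
     (compl_proj H V_H ** (J - D) ** H) *v (V_H *v x_Hr t) + (compl_proj H V_H ** B) *v u t"

definition alp_bound ::
  "real \<Rightarrow> real^'n^'n \<Rightarrow> real^'n^'n \<Rightarrow> real^'n^'n \<Rightarrow> real^'k^'n \<Rightarrow>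
   (real \<Rightarrow> real^'n) \<Rightarrow> (real \<Rightarrow> real^'k) \<Rightarrow> real \<Rightarrow> real" where
  "alp_bound t0 J D H V_A r e_r t = energy_norm H (V_A *v e_r t) +
     integral {t0..t} (\<lambda>s. energy_norm H (alp_residual J D H V_A r e_r s))"

definition hier_bound ::
  "real \<Rightarrow> real^'n^'n \<Rightarrow> real^'n^'n \<Rightarrow> real^'n^'n \<Rightarrow> real^'m^'n \<Rightarrow> (real \<Rightarrow> real^'m) \<Rightarrow>
   real^'l^'n \<Rightarrow> (real \<Rightarrow> real^'l) \<Rightarrow> real^'k^'n \<Rightarrow> (real \<Rightarrow> real^'k) \<Rightarrow> real \<Rightarrow> real" where
  "hier_bound t0 J D H B u V x_r V_H x_Hr t = energy_norm H (V_H *v x_Hr t - V *v x_r t) +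
     integral {t0..t} (\<lambda>s. energy_norm H (hier_residual J D H B u V_H x_Hr s))"

text \<open>
  Block concatenation \<open>[V V_plus]\<close> and, for vectors, \<open>[x; y]\<close>.  An injection \<open>\<iota>\<close> of the
  index type \<open>'l\<close> into the index type \<open>'k\<close> says where the first block sits (in the usual
  notation, the inclusion of \<open>{1..n}\<close> into \<open>{1..n + n_plus}\<close>); the second block occupies the
  \<open>CARD('k) - CARD('l)\<close> indices outside \<open>range \<iota>\<close>, and only those entries of the last argument
  are used.  A sum type \<open>'l + 'p\<close> would exclude an empty second block, since types are nonempty.
\<close>

definition vec_block :: "('l \<Rightarrow> 'k) \<Rightarrow> real^'l \<Rightarrow> real^'k \<Rightarrow> real^'k" where
  "vec_block \<iota> x y = (\<chi> k. if k \<in> range \<iota> then x $ inv \<iota> k else y $ k)"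

definition col_block :: "('l \<Rightarrow> 'k) \<Rightarrow> real^'l^'n \<Rightarrow> real^'k^'n \<Rightarrow> real^'k^'n" where
  "col_block \<iota> V V_plus = (\<chi> i. vec_block \<iota> (V $ i) (V_plus $ i))"

end

theory Submission
  imports Defs
begin

text \<open>
  Write \<open>W = V_A = V_H = [V V_plus]\<close> and \<open>z = W x_Hr - V x_r - W e_r\<close>.  Since \<open>V y = W [y; 0]\<close>,
  the function \<open>z\<close> takes values in the range of \<open>W\<close>, starts at \<open>0\<close> and solves the Galerkin
  projection of the homogeneous system \<open>z' = (J - D) H z\<close>.  The energy \<open>z \<bullet> H z\<close> has derivative
  \<open>- 2 (H z) \<bullet> D (H z) \<le> 0\<close>, so \<open>z\<close> vanishes and \<open>W e_r = W x_Hr - V x_r\<close>.  The residuals then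
  coincide because the complementary projection annihilates \<open>W\<close>, hence also \<open>V\<close>.
\<close>

lemma inner_matrix_transpose:
  fixes A :: "real^'n^'m"
  shows "x \<bullet> (A *v y) = (transpose A *v x) \<bullet> y"
  by (simp add: dot_lmul_matrix)

text \<open>Symmetry of \<open>H\<close> turns the derivative of the energy
  \<open>z \<bullet> H z\<close> into \<open>2 (z \<bullet> H z')\<close>, so the energy cannot
  increase from its initial value 0, whereas definiteness makes it positive wherever
  \<open>z\<close> is nonzero.\<close>

lemma dissipative_imp_zero:
  fixes H :: "real^'n^'n" and z z' :: "real \<Rightarrow> real^'n"
  assumes H: "symmetric_pos_def H"
    and deriv: "\<And>t. t \<in> {a..b} \<Longrightarrow> (z has_vector_derivative z' t) (at t within {a..b})"
    and diss: "\<And>t. t \<in> {a..b} \<Longrightarrow> z t \<bullet> (H *v z' t) \<le> 0"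
    and "z a = 0" and t: "t \<in> {a..b}"
  shows "z t = 0"
proof (rule ccontr)
  assume nz: "z t \<noteq> 0"
  define E where "E s = z s \<bullet> (H *v z s)" for s
  have E_deriv: "(E has_real_derivative 2 * (z s \<bullet> (H *v z' s))) (at s within {a..b})"
    if s: "s \<in> {a..b}" for s
  proof -
    have "((\<lambda>s. H *v z s) has_vector_derivative H *v z' s) (at s within {a..b})"
      by (rule bounded_linear.has_vector_derivative[OF matrix_vector_mul_bounded_linear deriv[OF s]])
    from bounded_bilinear.has_vector_derivative[OF bounded_bilinear_inner deriv[OF s] this]
    have "(E has_vector_derivative z s \<bullet> (H *v z' s) + z' s \<bullet> (H *v z s)) (at s within {a..b})"
      unfolding E_def .
    moreover have "z' s \<bullet> (H *v z s) = z s \<bullet> (H *v z' s)"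
      using H inner_matrix_transpose[of "z s" H "z' s"]
      by (simp only: symmetric_pos_def_def inner_commute)
    ultimately show ?thesis
      by (simp add: has_real_derivative_iff_has_vector_derivative)
  qed
  have "E t \<le> E a"
  \<comment> \<open>At the end points only one-sided derivatives are available. Two-sided ones exist
    in the interior, and continuity extends monotonicity to the closed interval.\<close>
  proof (rule DERIV_nonpos_imp_decreasing_open[where f = E])
    show "a \<le> t" using t by simp
    show "\<exists>y. (E has_real_derivative y) (at s) \<and> y \<le> 0" if "a < s" "s < t" for s
    proof -
      have s: "s \<in> {a..b}" and "s \<in> interior {a..b}" using that t by auto
      then have "at s within {a..b} = at s" by (metis at_within_interior)
      then show ?thesis
        using E_deriv[OF s] diss[OF s] by (intro exI[of _ "2 * (z s \<bullet> (H *v z' s))"]) simp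
    qed
    show "continuous_on {a..t} E"
      by (rule DERIV_continuous_on[OF DERIV_subset[OF E_deriv]]) (use t in auto)
  qed
  moreover have "E a = 0" using \<open>z a = 0\<close> by (simp add: E_def)
  moreover have "0 < E t" using H nz by (simp add: E_def symmetric_pos_def_def)
  ultimately show False by simp
qed

text \<open>With \<open>a < b\<close> every point of the interval is a limit point of it, so the
  derivative within the interval is unique and \<open>deriv_on\<close> agrees with the continuous
  witness from \<open>C1_on\<close>.\<close>

lemma C1_on_deriv_on:
  assumes "C1_on a b f" "a < b"
  shows "continuous_on {a..b} f"
    and "continuous_on {a..b} (deriv_on a b f)"
    and "\<And>t. t \<in> {a..b} \<Longrightarrow> (f has_vector_derivative deriv_on a b f t) (at t within {a..b})"
proof -
  obtain f' where cont: "continuous_on {a..b} f'"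
    and f': "\<And>t. t \<in> {a..b} \<Longrightarrow> (f has_vector_derivative f' t) (at t within {a..b})"
    using assms(1) unfolding C1_on_def by blast
  have eq: "deriv_on a b f t = f' t" if "t \<in> {a..b}" for t
    using assms(2) that f'[OF that]
    by (intro vector_derivative_within) (simp_all add: trivial_limit_within islimpt_Icc)
  show "continuous_on {a..b} f"
    using f' by (intro continuous_on_vector_derivative)
  show "continuous_on {a..b} (deriv_on a b f)"
    using cont by (rule continuous_on_eq) (simp add: eq)
  show "(f has_vector_derivative deriv_on a b f t) (at t within {a..b})" if "t \<in> {a..b}" for t
    using f'[OF that] eq[OF that] by simp
qed

text \<open>The padding zeros cancel the columns of \<open>V_plus\<close>, and the sum over
  \<open>range \<iota>\<close> reindexes to the columns of \<open>V\<close>. This embeds the range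
  of \<open>V\<close> into that of the enlarged basis.\<close>

lemma col_block_mult_vec_block:
  fixes \<iota> :: "'n::finite \<Rightarrow> 'k::finite"
  assumes "inj \<iota>"
  shows "col_block \<iota> V V_plus *v vec_block \<iota> x 0 = V *v x"
proof -
  have "(\<Sum>k\<in>UNIV. vec_block \<iota> (V $ i) (V_plus $ i) $ k * vec_block \<iota> x 0 $ k)
      = (\<Sum>j\<in>UNIV. V $ i $ j * x $ j)" for i
  proof -
    have "(\<Sum>k\<in>UNIV. vec_block \<iota> (V $ i) (V_plus $ i) $ k * vec_block \<iota> x 0 $ k)
        = (\<Sum>k\<in>range \<iota>. vec_block \<iota> (V $ i) (V_plus $ i) $ k * vec_block \<iota> x 0 $ k)"
      by (rule sum.mono_neutral_right) (auto simp: vec_block_def)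
    also have "\<dots> = (\<Sum>j\<in>UNIV. V $ i $ j * x $ j)"
      by (subst sum.reindex[OF assms]) (simp add: vec_block_def assms)
    finally show ?thesis .
  qed
  then show ?thesis
    by (simp add: vec_eq_iff matrix_vector_mult_def col_block_def)
qed

text \<open>The Gram matrix \<open>?M\<close> is invertible: if it kills \<open>y\<close>, the
  energy of \<open>W y\<close> is 0, so \<open>W y = 0\<close> by definiteness and
  \<open>y = 0\<close> by full column rank. Its inverse then cancels in the projection applied to
  \<open>W\<close>.\<close>

lemma compl_proj_annihilates:
  fixes W :: "real^'k^'n"
  assumes H: "symmetric_pos_def H" and W: "full_column_rank W"
  shows "compl_proj H W *v (W *v y) = 0"
proof -
  let ?M = "transpose W ** H ** W"
  have "y = 0" if "?M *v y = 0" for y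
  proof -
    have "(W *v y) \<bullet> (H *v (W *v y)) = y \<bullet> (?M *v y)"
      using inner_matrix_transpose[of y "transpose W"]
      by (simp only: transpose_transpose flip: matrix_vector_mul_assoc)
    then have "W *v y = 0"
      using H that unfolding symmetric_pos_def_def by fastforce
    moreover have "inj ((*v) W)"
      using W by (simp add: full_column_rank_def full_rank_injective)
    ultimately show "y = 0"
      by (metis injD matrix_vector_mult_0_right)
  qed
  then have "invertible ?M"
    using matrix_left_invertible_ker[of ?M] invertible_left_inverse[of ?M] by blast
  then have "matrix_inv ?M ** ?M = mat 1"
    unfolding invertible_def matrix_inv_def by (rule someI2_ex) blast
  then have "W ** matrix_inv ?M ** transpose W ** H ** W = W"
    by (simp only: matrix_mul_rid flip: matrix_mul_assoc)
  then show ?thesis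
    unfolding compl_proj_def matrix_vector_mult_diff_rdistrib by (simp add: matrix_vector_mul_assoc)
qed

lemma energy_norm_nonneg:
  "symmetric_pos_def H \<Longrightarrow> 0 \<le> energy_norm H v"
  by (cases "v = 0") (auto simp: energy_norm_def symmetric_pos_def_def less_imp_le)

lemma continuous_on_energy_norm:
  "continuous_on S f \<Longrightarrow> continuous_on S (\<lambda>s. energy_norm H (f s))"
  unfolding energy_norm_def
  by (intro continuous_intros bounded_linear.continuous_on[OF matrix_vector_mul_bounded_linear])

text \<open>Skew symmetry makes \<open>q \<bullet> (J q)\<close> equal to its own negative, so only
  the dissipative part \<open>D\<close> remains.\<close>

lemma skew_minus_psd_quadratic_nonpos:
  assumes "skew_symmetric J" "symmetric_pos_semidef D"
  shows "q \<bullet> ((J - D) *v q) \<le> 0"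
proof -
  have "q \<bullet> (J *v q) = - (q \<bullet> (J *v q))"
    using inner_matrix_transpose[of q J q] assms(1) matrix_vector_mult_diff_rdistrib[of 0 J q]
    by (simp add: skew_symmetric_def inner_commute del: transpose_matrix_vector)
  moreover have "0 \<le> q \<bullet> (D *v q)"
    using assms(2) by (simp add: symmetric_pos_semidef_def)
  ultimately show ?thesis
    by (simp add: matrix_vector_mult_diff_rdistrib inner_diff_right)
qed

theorem proposition1:
  fixes t0 T :: real
    and J D H :: "real^'N^'N" and B :: "real^'m^'N"
    and u :: "real \<Rightarrow> real^'m" and x0 :: "real^'N" and x :: "real \<Rightarrow> real^'N"
    and V :: "real^'n^'N" and V_A V_H V_plus :: "real^'k^'N" and \<iota> :: "'n \<Rightarrow> 'k"
    and x_r :: "real \<Rightarrow> real^'n" and e_r x_Hr :: "real \<Rightarrow> real^'k"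
    and r :: "real \<Rightarrow> real^'N"
  assumes "t0 < T"
    and "symmetric_pos_def H" and "skew_symmetric J" and "symmetric_pos_semidef D"
    and "full_column_rank V" and "full_column_rank V_A" and "full_column_rank V_H"
    and "ph_solution t0 T J D H B u x0 x"
    and "reduced_solution t0 T J D H V (\<lambda>t. B *v u t) (transpose V ** H *v x0) x_r"
    and "r = residual t0 T J D H B u V x_r"
    and "reduced_solution t0 T J D H V_A r 0 e_r"
    and "reduced_solution t0 T J D H V_H (\<lambda>t. B *v u t) (transpose V_H ** H *v x0) x_Hr"
    and "inj \<iota>"
    and "V_A = col_block \<iota> V V_plus" and "V_H = col_block \<iota> V V_plus"
    and "e_r t0 = x_Hr t0 - vec_block \<iota> (x_r t0) 0"
  shows "\<forall>t\<in>{t0..T}.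
    (\<lambda>s. energy_norm H (alp_residual J D H V_A r e_r s)) integrable_on {t0..t} \<and>
    (\<lambda>s. energy_norm H (hier_residual J D H B u V_H x_Hr s)) integrable_on {t0..t} \<and>
    alp_bound t0 J D H V_A r e_r t = hier_bound t0 J D H B u V x_r V_H x_Hr t \<and>
    0 \<le> alp_bound t0 J D H V_A r e_r t"
proof -
  define W where "W = col_block \<iota> V V_plus"
  have VA: "V_A = W" and VH: "V_H = W" using assms(14,15) by (simp_all add: W_def)
  note H = assms(2)
  have V: "V *v y = W *v vec_block \<iota> y 0" for y
    by (simp add: W_def col_block_mult_vec_block[OF assms(13)])
  have C1: "C1_on t0 T x" "C1_on t0 T x_r" "C1_on t0 T e_r" "C1_on t0 T x_Hr"
    using assms(8,9,11,12) by (simp_all add: ph_solution_def reduced_solution_def)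
  note derivs = C1[THEN C1_on_deriv_on(3), OF assms(1)]

  \<comment> \<open>The coordinates of \<open>z\<close> in the basis \<open>W\<close>; they are
    needed below as the test vector. Differentiation takes place only after applying
    \<open>W\<close>.\<close>
  define w where "w t = x_Hr t - vec_block \<iota> (x_r t) 0 - e_r t" for t
  define w' where
    "w' t = deriv_on t0 T x_Hr t - vec_block \<iota> (deriv_on t0 T x_r t) 0 - deriv_on t0 T e_r t" for t
  have Ww: "W *v w t = W *v x_Hr t - V *v x_r t - W *v e_r t" for t
    by (simp add: w_def V matrix_vector_mult_diff_distrib)
  have Ww': "W *v w' t = W *v deriv_on t0 T x_Hr t - V *v deriv_on t0 T x_r t
      - W *v deriv_on t0 T e_r t" for t
    by (simp add: w'_def V matrix_vector_mult_diff_distrib)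

  have w_zero: "W *v w t = 0" if "t \<in> {t0..T}" for t
  proof (rule dissipative_imp_zero[OF H _ _ _ that])
    show "((\<lambda>t. W *v w t) has_vector_derivative W *v w' s) (at s within {t0..T})"
      if "s \<in> {t0..T}" for s
      unfolding Ww Ww'
      by (intro has_vector_derivative_diff derivs[OF that]
          bounded_linear.has_vector_derivative[OF matrix_vector_mul_bounded_linear])
    show "W *v w t0 = 0"
      using assms(16) by (simp add: w_def)
    show "(W *v w s) \<bullet> (H *v (W *v w' s)) \<le> 0" if s: "s \<in> {t0..T}" for s
    proof -
      let ?G = "\<lambda>y. transpose W *v (H *v y)" and ?A = "\<lambda>y. (J - D) *v (H *v y)"
      have eH: "?G (W *v deriv_on t0 T x_Hr s) = ?G (?A (W *v x_Hr s)) + ?G (B *v u s)"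
        using assms(12) s by (simp add: reduced_solution_def VH flip: matrix_vector_mul_assoc)
      have eE: "?G (W *v deriv_on t0 T e_r s) = ?G (?A (W *v e_r s)) +
          ?G (?A (V *v x_r s) + B *v u s - V *v deriv_on t0 T x_r s)"
        using assms(11) s
        by (simp add: reduced_solution_def VA assms(10) residual_def flip: matrix_vector_mul_assoc)
      \<comment> \<open>On subtracting \<open>eE\<close> from \<open>eH\<close> the input terms
        cancel, and the residual inside \<open>eE\<close> supplies exactly the \<open>V x_r\<close>
        terms of \<open>z\<close> and its derivative.\<close>
      have "?G (W *v w' s) = ?G (?A (W *v w s))"
        unfolding Ww Ww' using eH eE
        by (simp add: matrix_vector_mult_diff_distrib matrix_vector_right_distrib)
      \<comment> \<open>Testing with \<open>w s\<close> moves \<open>transpose W\<close> to the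
        other side, so the projected equation is tested with \<open>z\<close> itself.\<close>
      then have "w s \<bullet> ?G (W *v w' s) = w s \<bullet> ?G (?A (W *v w s))"
        by simp
      then have "(W *v w s) \<bullet> (H *v (W *v w' s)) = (W *v w s) \<bullet> (H *v ?A (W *v w s))"
        by (simp only: inner_matrix_transpose transpose_transpose)
      also have "\<dots> = (H *v (W *v w s)) \<bullet> ?A (W *v w s)"
        using H inner_matrix_transpose[of _ H] by (simp only: symmetric_pos_def_def)
      finally show ?thesis
        using skew_minus_psd_quadratic_nonpos[OF assms(3,4)] by simp
    qed
  qed
  have lift: "W *v e_r t = W *v x_Hr t - V *v x_r t" if "t \<in> {t0..T}" for t
    using w_zero[OF that] by (simp add: Ww)

  \<comment> \<open>By \<open>lift\<close> the \<open>V x_r\<close> terms cancel. What is left over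
    is the projection of \<open>V\<close> times the derivative of \<open>x_r\<close>, which vanishes
    as this vector lies in the range of \<open>W\<close>.\<close>
  have res: "alp_residual J D H V_A r e_r s = hier_residual J D H B u V_H x_Hr s"
    if "s \<in> {t0..T}" for s
    using lift[OF that] compl_proj_annihilates[OF H assms(7)]
    by (simp add: alp_residual_def hier_residual_def residual_def assms(10) VA VH V
        matrix_vector_mult_diff_distrib matrix_vector_right_distrib flip: matrix_vector_mul_assoc)

  text \<open>The input \<open>u\<close> may be irregular; only \<open>B u\<close> is continuous, as \<open>x' - (J - D) H x\<close>.\<close>
  have Bu: "B *v u s = deriv_on t0 T x s - (J - D) ** H *v x s" if "s \<in> {t0..T}" for s
    using assms(8) that by (simp add: ph_solution_def)
  have "continuous_on {t0..T} (\<lambda>s. deriv_on t0 T x s - (J - D) ** H *v x s)"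
    by (intro continuous_intros C1_on_deriv_on C1 assms(1)
        bounded_linear.continuous_on[OF matrix_vector_mul_bounded_linear])
  then have Bu_cont: "continuous_on {t0..T} (\<lambda>s. B *v u s)"
    by (rule continuous_on_eq) (simp add: Bu)
  have hier_cont: "continuous_on {t0..T} (\<lambda>s. hier_residual J D H B u V_H x_Hr s)"
    unfolding hier_residual_def matrix_vector_mul_assoc[of _ B, symmetric]
    by (intro continuous_intros C1_on_deriv_on(1)[OF C1(4) assms(1)] Bu_cont
        bounded_linear.continuous_on[OF matrix_vector_mul_bounded_linear])

  show ?thesis
  proof
    fix t assume t: "t \<in> {t0..T}"
    let ?a = "\<lambda>s. energy_norm H (alp_residual J D H V_A r e_r s)"
    let ?h = "\<lambda>s. energy_norm H (hier_residual J D H B u V_H x_Hr s)"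
    have eq: "?a s = ?h s" if "s \<in> {t0..t}" for s
      using res that t by simp
    \<comment> \<open>Since \<open>integral\<close> is 0 by default for non-integrable functions,
      integrability is what gives the equality of the bounds its intended meaning.\<close>
    have "?h integrable_on {t0..t}"
      by (intro integrable_continuous_real continuous_on_energy_norm
          continuous_on_subset[OF hier_cont]) (use t in auto)
    moreover from this have "?a integrable_on {t0..t}"
      by (rule integrable_eq) (simp add: eq)
    moreover have "alp_bound t0 J D H V_A r e_r t = hier_bound t0 J D H B u V x_r V_H x_Hr t"
      unfolding alp_bound_def hier_bound_def using integral_cong[of "{t0..t}" ?a ?h, OF eq] lift[OF t]
      by (simp add: VA VH)
    moreover have "0 \<le> alp_bound t0 J D H V_A r e_r t"
      unfolding alp_bound_def
      by (intro add_nonneg_nonneg integral_nonneg energy_norm_nonneg H calculation)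
    ultimately show "?a integrable_on {t0..t} \<and> ?h integrable_on {t0..t} \<and>
        alp_bound t0 J D H V_A r e_r t = hier_bound t0 J D H B u V x_r V_H x_Hr t \<and>
        0 \<le> alp_bound t0 J D H V_A r e_r t"
      by blast
  qed
qed

end
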